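(* Let $A^{\tau}(t,z)=\sum_{n,k\ge0}a^{\tau}_{n,k}t^nz^k$, where $a^{\tau}_{n,k}$ is the number of permutations in $S_n$ avoiding the classical pattern $3\textrm{-}1\textrm{-}2$ and containing exactly $k$ occurrences of the consecutive pattern $\tau$. Then $A^{123}(t,z)=A^{321}(t,z)$.
   Context: A permutation $\sigma\in S_n$ avoids the classical pattern $3\textrm{-}1\textrm{-}2$ if there are no indices $i<j<l$ with $\sigma(j)<\sigma(l)<\sigma(i)$. An occurrence of the consecutive pattern $123$ (resp. $321$) in $\sigma$ is an index $i$ with $\sigma(i)<\sigma(i+1)<\sigma(i+2)$ (resp. $\sigma(i)>\sigma(i+1)>\sigma(i+2)$). *)

theory Defs
  imports "HOL-Combinatorics.Permutations" "HOL-Computational_Algebra.Formal_Power_Series"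
begin

text \<open>Elements of \<open>S\<^sub>n\<close> are functions \<open>\<sigma>\<close> with \<open>\<sigma> permutes {1..n}\<close>, i.e. bijections of
  \<open>{1..n}\<close> extended by the identity outside of \<open>{1..n}\<close>.\<close>

definition avoids_312 :: "nat \<Rightarrow> (nat \<Rightarrow> nat) \<Rightarrow> bool" where
  "avoids_312 n \<sigma> \<longleftrightarrow>
     \<not> (\<exists>i j l. 1 \<le> i \<and> i < j \<and> j < l \<and> l \<le> n \<and> \<sigma> j < \<sigma> l \<and> \<sigma> l < \<sigma> i)"

definition occ_123 :: "nat \<Rightarrow> (nat \<Rightarrow> nat) \<Rightarrow> nat set" where
  "occ_123 n \<sigma> = {i. 1 \<le> i \<and> i + 2 \<le> n \<and> \<sigma> i < \<sigma> (i + 1) \<and> \<sigma> (i + 1) < \<sigma> (i + 2)}"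

definition occ_321 :: "nat \<Rightarrow> (nat \<Rightarrow> nat) \<Rightarrow> nat set" where
  "occ_321 n \<sigma> = {i. 1 \<le> i \<and> i + 2 \<le> n \<and> \<sigma> i > \<sigma> (i + 1) \<and> \<sigma> (i + 1) > \<sigma> (i + 2)}"

text \<open>The consecutive pattern \<open>\<tau>\<close> is represented by the function \<open>occ\<close> that returns the set of
  its occurrences in a permutation of \<open>{1..n}\<close>.\<close>

definition num_avoiders :: "(nat \<Rightarrow> (nat \<Rightarrow> nat) \<Rightarrow> nat set) \<Rightarrow> nat \<Rightarrow> nat \<Rightarrow> nat" where
  "num_avoiders occ n k =
     card {\<sigma>. \<sigma> permutes {1..n} \<and> avoids_312 n \<sigma> \<and> card (occ n \<sigma>) = k}"

text \<open>The bivariate series in \<open>t, z\<close> is a power series in \<open>t\<close> (outer) whose coefficients are power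
  series in \<open>z\<close> (inner).\<close>

definition avoiders_gf :: "(nat \<Rightarrow> (nat \<Rightarrow> nat) \<Rightarrow> nat set) \<Rightarrow> int fps fps" where
  "avoiders_gf occ = Abs_fps (\<lambda>n. Abs_fps (\<lambda>k. int (num_avoiders occ n k)))"

end

theory Submission
  imports Defs "HOL-Library.Tree"
begin

text \<open>
  Splitting a 312-avoiding word at its minimum gives \<open>L @ m # R\<close>, where every letter of \<open>L\<close> is
  smaller than every letter of \<open>R\<close> and \<open>L\<close>, \<open>R\<close> again avoid 312. Iterating this identifies the
  312-avoiding permutations of length \<open>n\<close> with the binary trees with \<open>n\<close> inner nodes. An occurrence
  of 123 meeting the minimum exists iff \<open>R\<close> starts with an ascent, and then there is exactly one;
  an occurrence of 321 meeting the minimum exists iff \<open>L\<close> ends with a descent. Both conditions can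
  be read off the tree, and they are exchanged by reflecting the tree, so that reflection is a
  bijection that carries the statistic 123 to the statistic 321.
\<close>

section \<open>Patterns in words and the split at the minimum\<close>

text \<open>The recursion runs over the letter that plays the 3, so that claims about avoidance go
  by structural induction on the word.\<close>

fun list_avoids_312 :: "'a::linorder list \<Rightarrow> bool" where
  "list_avoids_312 [] \<longleftrightarrow> True"
| "list_avoids_312 (x # xs) \<longleftrightarrow>
     sorted_wrt (\<lambda>y z. \<not> (y < z \<and> z < x)) xs \<and> list_avoids_312 xs"

fun runs3 :: "('a \<Rightarrow> 'a \<Rightarrow> bool) \<Rightarrow> 'a list \<Rightarrow> nat" where
  "runs3 P (x # y # z # xs) = of_bool (P x y \<and> P y z) + runs3 P (y # z # xs)"
| "runs3 P _ = 0"

fun starts_with_ascent :: "'a::linorder list \<Rightarrow> bool" where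
  "starts_with_ascent (x # y # xs) \<longleftrightarrow> x < y"
| "starts_with_ascent _ \<longleftrightarrow> False"

text \<open>The minimum \<open>m\<close> can only play the 1. Any occurrence not contained in
  \<open>xs\<close> or \<open>ys\<close> has its 3 in \<open>xs\<close> and its 2 in
  \<open>ys\<close>; conversely \<open>x > y\<close> across the split yields the occurrence
  \<open>x\<close>, \<open>m\<close>, \<open>y\<close>.\<close>

lemma list_avoids_312_split_min:
  assumes "\<forall>x \<in> set xs. m < x" "\<forall>y \<in> set ys. m < y"
  shows "list_avoids_312 (xs @ m # ys) \<longleftrightarrow>
    list_avoids_312 xs \<and> list_avoids_312 ys \<and> (\<forall>x \<in> set xs. \<forall>y \<in> set ys. x \<le> y)"
  using assms(1)
proof (induction xs)
  case Nil
  have "\<forall>i < length ys. \<not> ys ! i < m"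
    using assms(2) by (meson nth_mem not_less_iff_gr_or_eq)
  then have "sorted_wrt (\<lambda>y z. \<not> (y < z \<and> z < m)) ys"
    unfolding sorted_wrt_iff_nth_less by blast
  then show ?case by simp
next
  case (Cons x xs)
  let ?P = "\<lambda>y z. \<not> (y < z \<and> z < x)"
  have "sorted_wrt ?P (xs @ m # ys) \<longleftrightarrow> sorted_wrt ?P xs \<and> (\<forall>y \<in> set ys. x \<le> y)"
  proof
    assume "sorted_wrt ?P (xs @ m # ys)"
    then have "sorted_wrt ?P xs" "\<forall>y \<in> set ys. ?P m y"
      unfolding sorted_wrt_append sorted_wrt.simps by blast+
    with assms(2) show "sorted_wrt ?P xs \<and> (\<forall>y \<in> set ys. x \<le> y)"
      by (meson not_less)
  next
    assume *: "sorted_wrt ?P xs \<and> (\<forall>y \<in> set ys. x \<le> y)"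
    then have P: "?P y z" if "z \<in> set ys" for y z
      using that by (meson not_less)
    then have "sorted_wrt ?P ys"
      unfolding sorted_wrt_iff_nth_less by (meson nth_mem)
    moreover have "?P y m" if "y \<in> set xs" for y
      using that Cons.prems by (meson list.set_intros(2) not_less_iff_gr_or_eq)
    ultimately show "sorted_wrt ?P (xs @ m # ys)"
      unfolding sorted_wrt_append sorted_wrt.simps set_simps using * P by blast
  qed
  moreover have "list_avoids_312 (xs @ m # ys) \<longleftrightarrow>
      list_avoids_312 xs \<and> list_avoids_312 ys \<and> (\<forall>x \<in> set xs. \<forall>y \<in> set ys. x \<le> y)"
    using Cons by simp
  ultimately show ?case
    unfolding append_Cons list_avoids_312.simps set_simps by blast
qed

text \<open>An increasing triple through \<open>m\<close> must start at \<open>m\<close>, since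
  every step into \<open>m\<close> is a descent. So at most one triple is gained, namely
  \<open>m\<close> followed by the first two letters of \<open>ys\<close>.\<close>

lemma runs3_less_split_min:
  fixes m :: "'a::linorder"
  assumes "\<forall>x \<in> set xs. m < x" "\<forall>y \<in> set ys. m < y"
  shows "runs3 (<) (xs @ m # ys) =
    runs3 (<) xs + runs3 (<) ys + of_bool (starts_with_ascent ys)"
  using assms
proof (induction "(<) :: 'a \<Rightarrow> 'a \<Rightarrow> bool" xs rule: runs3.induct)
  case (1 x y z xs)
  then show ?case by auto
next
  case "2_1"
  then show ?case by (cases ys rule: starts_with_ascent.cases) auto
next
  case ("2_2" x)
  then show ?case by (cases ys rule: starts_with_ascent.cases) auto
next
  case ("2_3" x y)
  then show ?case by (cases ys rule: starts_with_ascent.cases) auto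
qed

lemma starts_with_ascent_split_min:
  assumes "\<forall>x \<in> set xs. m < x" "\<forall>y \<in> set ys. m < y"
  shows "starts_with_ascent (xs @ m # ys) \<longleftrightarrow> xs = [] \<and> ys \<noteq> [] \<or> starts_with_ascent xs"
  using assms
  by (cases xs rule: starts_with_ascent.cases; cases ys) auto

section \<open>Occurrences as index sets, and reversal\<close>

lemma runs3_conv_card:
  "runs3 P xs = card {i. i + 2 < length xs \<and> P (xs ! i) (xs ! (i + 1)) \<and> P (xs ! (i + 1)) (xs ! (i + 2))}"
proof (induction P xs rule: runs3.induct)
  case (1 P x y z xs)
  define S where "S ws = {i. i + 2 < length ws \<and> P (ws ! i) (ws ! (i + 1)) \<and> P (ws ! (i + 1)) (ws ! (i + 2))}"
    for ws
  have fin: "finite (S (y # z # xs))"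
    by (rule finite_subset[of _ "{..<length (y # z # xs)}"]) (auto simp: S_def)
  \<comment> \<open>Index 0 is the front triple; all others are indices of the tail shifted by
    one.\<close>
  have "i \<in> S (x # y # z # xs) \<longleftrightarrow>
      i \<in> (if P x y \<and> P y z then {0} else {}) \<union> Suc ` S (y # z # xs)" for i
    by (cases i) (auto simp: S_def image_iff)
  then have "S (x # y # z # xs) = (if P x y \<and> P y z then {0} else {}) \<union> Suc ` S (y # z # xs)"
    by blast
  moreover have "card \<dots> = of_bool (P x y \<and> P y z) + card (S (y # z # xs))"
    using fin by (auto simp: card_image card_insert_if)
  ultimately show ?case
    using 1 by (simp add: S_def)
qed auto

lemma runs3_rev: "runs3 P (rev xs) = runs3 (\<lambda>x y. P y x) xs"
  unfolding runs3_conv_card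
proof (rule bij_betw_same_card)
  let ?n = "length xs"
  let ?A = "{i. i + 2 < length (rev xs) \<and> P (rev xs ! i) (rev xs ! (i + 1)) \<and>
                P (rev xs ! (i + 1)) (rev xs ! (i + 2))}"
  let ?B = "{i. i + 2 < ?n \<and> P (xs ! (i + 1)) (xs ! i) \<and> P (xs ! (i + 2)) (xs ! (i + 1))}"
  \<comment> \<open>The triple at \<open>i\<close> in \<open>rev xs\<close> occupies the positions
    \<open>?n - 3 - i\<close> to \<open>?n - 1 - i\<close> of \<open>xs\<close>, read backwards.
    Hence \<open>i \<mapsto> ?n - 3 - i\<close> matches the starting points.\<close>
  have nth: "rev xs ! i = xs ! (?n - 3 - i + 2)" "rev xs ! (i + 1) = xs ! (?n - 3 - i + 1)"
    "rev xs ! (i + 2) = xs ! (?n - 3 - i)" if "i + 2 < ?n" for i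
  proof -
    have "?n - Suc i = ?n - 3 - i + 2" "?n - Suc (i + 1) = ?n - 3 - i + 1"
      "?n - Suc (i + 2) = ?n - 3 - i"
      using that by auto
    then show "rev xs ! i = xs ! (?n - 3 - i + 2)" "rev xs ! (i + 1) = xs ! (?n - 3 - i + 1)"
      "rev xs ! (i + 2) = xs ! (?n - 3 - i)"
      using that by (simp_all only: rev_nth)
  qed
  have eq: "i \<in> ?A \<longleftrightarrow> ?n - 3 - i \<in> ?B" if "i + 2 < ?n" for i
    unfolding mem_Collect_eq nth[OF that] length_rev using that by auto
  show "bij_betw (\<lambda>i. ?n - 3 - i) ?A ?B"
  proof (rule bij_betw_byWitness[where f' = "\<lambda>i. ?n - 3 - i"])
    show "(\<lambda>i. ?n - 3 - i) ` ?A \<subseteq> ?B"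
    proof (rule image_subsetI)
      fix i assume i: "i \<in> ?A"
      then have "i + 2 < ?n" by simp
      from eq[OF this] i show "?n - 3 - i \<in> ?B" by blast
    qed
    show "(\<lambda>i. ?n - 3 - i) ` ?B \<subseteq> ?A"
    proof (rule image_subsetI)
      fix i assume i: "i \<in> ?B"
      then have "?n - 3 - i + 2 < ?n" "?n - 3 - (?n - 3 - i) = i" by auto
      with eq[of "?n - 3 - i"] i show "?n - 3 - i \<in> ?A" by metis
    qed
  qed auto
qed

section \<open>Binary trees and 312-avoiding words\<close>

text \<open>The inorder reading of the tree whose nodes are labelled \<open>a, a + 1, \<dots>\<close> in preorder.\<close>

fun tree_word :: "nat \<Rightarrow> unit tree \<Rightarrow> nat list" where
  "tree_word a Leaf = []"
| "tree_word a (Node l u r) = tree_word (Suc a) l @ a # tree_word (Suc a + size l) r"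

lemma length_tree_word [simp]: "length (tree_word a t) = size t"
  by (induction t arbitrary: a) auto

lemma set_tree_word [simp]: "set (tree_word a t) = {a..<a + size t}"
  by (induction t arbitrary: a) auto

lemma distinct_tree_word: "distinct (tree_word a t)"
  by (induction t arbitrary: a) auto

lemma tree_word_eq_Nil_iff [simp]: "tree_word a t = [] \<longleftrightarrow> t = Leaf"
  by (cases t) auto

text \<open>Discharges the side conditions of the split lemmas once the letter sets of tree words
  are rewritten to intervals.\<close>

lemma ball_atLeastLessThan_greater:
  fixes m a b :: "'a::preorder"
  shows "m < a \<Longrightarrow> \<forall>x \<in> {a..<b}. m < x"
  by (meson atLeastLessThan_iff less_le_trans)

text \<open>Preorder labelling makes the root the minimum and puts all labels of the left subtree
  below those of the right one.\<close>

lemma list_avoids_312_tree_word: "list_avoids_312 (tree_word a t)"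
proof (induction t arbitrary: a)
  case (Node l u r)
  then show ?case
    by (auto simp: list_avoids_312_split_min ball_atLeastLessThan_greater)
qed auto

lemma tree_word_inject: "tree_word a s = tree_word a t \<Longrightarrow> s = t"
proof (induction s arbitrary: a t)
  case Leaf
  then show ?case
    by (metis tree_word.simps(1) tree_word_eq_Nil_iff)
next
  case (Node l u r)
  then obtain l' u' r' where t: "t = Node l' u' r'"
    by (cases t) auto
  \<comment> \<open>The root label occurs only once, so its position cuts the word uniquely.\<close>
  have "a \<notin> set (tree_word (Suc a) l)" "a \<notin> set (tree_word (Suc a) l')"
    "a \<notin> set (tree_word (Suc a + size l) r)"
    by auto
  with Node.prems have eq: "tree_word (Suc a) l = tree_word (Suc a) l'"
    "tree_word (Suc a + size l) r = tree_word (Suc a + size l') r'"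
    unfolding t tree_word.simps by (auto simp: append_Cons_eq_iff simp del: set_tree_word)
  from eq(1) have "l = l'"
    by (rule Node.IH(1))
  \<comment> \<open>With \<open>l = l'\<close> the label offsets of the right subtrees agree, as the
    induction hypothesis requires.\<close>
  moreover from this eq(2) have "r = r'"
    by (auto intro: Node.IH(2))
  ultimately show ?case
    by (simp add: t)
qed

text \<open>Serves to show that the letters on either side of the minimum form intervals again. The
  reason is that \<open>A\<close> is closed downwards within the interval.\<close>

lemma split_interval_by_order:
  fixes a n :: nat
  assumes "A \<union> B = {a..<a + n}" "A \<inter> B = {}" "\<forall>x \<in> A. \<forall>y \<in> B. x \<le> y"
  shows "A = {a..<a + card A}" "B = {a + card A..<a + n}"
proof -
  have fin: "finite A" "finite B"
    using assms(1) by (metis finite_Un finite_atLeastLessThan)+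
  have down: "{a..x} \<subseteq> A" if "x \<in> A" for x
  proof
    fix y assume y: "y \<in> {a..x}"
    have "x < a + n" using that assms(1) by auto
    with y have "y \<in> A \<union> B" using assms(1) by auto
    \<comment> \<open>If \<open>y\<close> were in \<open>B\<close>, then \<open>x \<le> y\<close>
      and \<open>y \<le> x\<close> would put \<open>x\<close> into both sets.\<close>
    moreover have "y \<notin> B" using assms(2,3) that y by force
    ultimately show "y \<in> A" by blast
  qed
  show A: "A = {a..<a + card A}"
  proof (cases "A = {}")
    case False
    have A: "A = {a..Max A}"
      using down[OF Max_in[OF fin(1) False]] fin assms(1) by auto
    then have "card A = Suc (Max A) - a"
      by (metis card_atLeastAtMost)
    moreover have "a \<le> Max A"
      using Max_in[OF fin(1) False] assms(1) by auto
    ultimately have "a + card A = Suc (Max A)"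
      by simp
    with A show ?thesis
      by (metis atLeastLessThanSuc_atLeastAtMost)
  qed auto
  have "B = {a..<a + n} - A"
    using assms(1,2) by blast
  also have "\<dots> = {a + card A..<a + n}"
    by (subst A) auto
  finally show "B = {a + card A..<a + n}" .
qed

lemma tree_word_surj:
  assumes "distinct xs" "set xs = {a..<a + length xs}" "list_avoids_312 xs"
  shows "\<exists>t. xs = tree_word a t"
  using assms
proof (induction xs arbitrary: a rule: length_induct)
  case (1 xs)
  show ?case
  proof (cases "xs = []")
    case True
    then show ?thesis by (auto intro: exI[of _ Leaf])
  next
    case False
    \<comment> \<open>The least letter \<open>a\<close> must be the root label.\<close>
    then have "a \<in> set xs" using "1.prems" by auto
    then obtain L R where xs: "xs = L @ a # R"
      by (meson split_list)
    have "set L \<union> set R = set xs - {a}"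
      using "1.prems"(1) xs by auto
    also have "\<dots> = {a..<a + length xs} - {a}"
      by (simp only: "1.prems"(2))
    also have "\<dots> = {Suc a..<Suc a + (length L + length R)}"
      by (auto simp: xs)
    finally have LR: "set L \<union> set R = {Suc a..<Suc a + (length L + length R)}" .
    have "a < x" if "x \<in> set L \<union> set R" for x
      using that unfolding LR by simp
    then have av: "list_avoids_312 L" "list_avoids_312 R" "\<forall>x \<in> set L. \<forall>y \<in> set R. x \<le> y"
      using "1.prems"(3) xs by (auto simp: list_avoids_312_split_min)
    have dist: "distinct L" "distinct R" "set L \<inter> set R = {}"
      using "1.prems"(1) xs by auto
    \<comment> \<open>These are the label ranges that \<open>tree_word\<close> gives to the two
      subtrees, so the induction hypothesis applies to \<open>L\<close> and \<open>R\<close> with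
      these offsets.\<close>
    have "set L = {Suc a..<Suc a + length L}"
      "set R = {Suc a + length L..<Suc a + length L + length R}"
      using split_interval_by_order[OF LR dist(3) av(3)] dist by (simp_all add: distinct_card add_ac)
    then obtain l r where "L = tree_word (Suc a) l" "R = tree_word (Suc a + length L) r"
      using "1.IH"[rule_format, of L "Suc a"] "1.IH"[rule_format, of R "Suc a + length L"] av dist xs
      by auto
    then have "xs = tree_word a (Node l () r)"
      using xs by simp
    then show ?thesis by blast
  qed
qed

lemma bij_betw_tree_word:
  "bij_betw (tree_word 1) {t. size t = n} {xs. distinct xs \<and> set xs = {1..n} \<and> list_avoids_312 xs}"
proof (rule bij_betw_imageI)
  show "inj_on (tree_word 1) {t. size t = n}"
    by (auto intro: inj_onI tree_word_inject)
  show "tree_word 1 ` {t. size t = n} = {xs. distinct xs \<and> set xs = {1..n} \<and> list_avoids_312 xs}"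
  proof (intro equalityI subsetI)
    fix xs assume xs: "xs \<in> {xs. distinct xs \<and> set xs = {1..n} \<and> list_avoids_312 xs}"
    then have len: "length xs = n"
      using distinct_card[of xs] by simp
    have "set xs = {1..<1 + length xs}"
      unfolding len using xs by (simp add: atLeastLessThanSuc_atLeastAtMost)
    with xs obtain t where "xs = tree_word 1 t"
      using tree_word_surj[of xs 1] by blast
    with len show "xs \<in> tree_word 1 ` {t. size t = n}"
      by (intro image_eqI) auto
  qed (auto simp: distinct_tree_word list_avoids_312_tree_word)
qed

section \<open>Reflection of trees\<close>

text \<open>Reversing a tree word exchanges the subtree words around the root, which stays minimal,
  so the split lemma applies on both sides. The offsets \<open>a\<close> and \<open>b\<close> are
  independent because reflection changes the labels of the subtrees.\<close>

lemma starts_with_ascent_rev_tree_word: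
  "starts_with_ascent (rev (tree_word a t)) = starts_with_ascent (tree_word b (mirror t))"
proof (induction t arbitrary: a b)
  case (Node l u r)
  show ?case
    by (simp add: starts_with_ascent_split_min ball_atLeastLessThan_greater
        Node.IH(2)[where b = "Suc b"])
qed auto

text \<open>Both words split at their minimum. The contribution of the root depends on the left
  subtree \<open>l\<close>, whose mirror image stands to the right of the root and has offset
  \<open>Suc (b + size r)\<close>.\<close>

lemma runs3_rev_tree_word:
  "runs3 (<) (rev (tree_word a t)) = runs3 (<) (tree_word b (mirror t))"
proof (induction t arbitrary: a b)
  case (Node l u r)
  show ?case
    by (simp add: runs3_less_split_min ball_atLeastLessThan_greater
        starts_with_ascent_rev_tree_word[where b = "Suc (b + size r)"]
        Node.IH(1)[where b = "Suc (b + size r)"] Node.IH(2)[where b = "Suc b"])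
qed auto

section \<open>Permutations as words\<close>

definition one_line :: "nat \<Rightarrow> (nat \<Rightarrow> nat) \<Rightarrow> nat list" where
  "one_line n \<sigma> = map \<sigma> [1..<Suc n]"

lemma length_one_line [simp]: "length (one_line n \<sigma>) = n"
  by (simp add: one_line_def)

lemma nth_one_line [simp]: "i < n \<Longrightarrow> one_line n \<sigma> ! i = \<sigma> (Suc i)"
  by (simp add: one_line_def del: upt_Suc)

lemma bij_betw_one_line:
  "bij_betw (one_line n) {\<sigma>. \<sigma> permutes {1..n}} {xs. distinct xs \<and> set xs = {1..n}}"
proof (rule bij_betw_imageI)
  show "inj_on (one_line n) {\<sigma>. \<sigma> permutes {1..n}}"
  proof (rule inj_onI, rule ext)
    fix \<sigma> \<tau> i
    assume *: "\<sigma> \<in> {\<sigma>. \<sigma> permutes {1..n}}" "\<tau> \<in> {\<sigma>. \<sigma> permutes {1..n}}"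
      "one_line n \<sigma> = one_line n \<tau>"
    show "\<sigma> i = \<tau> i"
    proof (cases "i \<in> {1..n}")
      case True
      then obtain j where "i = Suc j" "j < n"
        by (cases i) auto
      then show ?thesis
        using *(3) nth_one_line by metis
    next
      case False
      then show ?thesis using * by (simp add: permutes_not_in)
    qed
  qed
  show "one_line n ` {\<sigma>. \<sigma> permutes {1..n}} = {xs. distinct xs \<and> set xs = {1..n}}"
  proof (intro equalityI subsetI)
    fix xs assume "xs \<in> one_line n ` {\<sigma>. \<sigma> permutes {1..n}}"
    then obtain \<sigma> where \<sigma>: "\<sigma> permutes {1..n}" "xs = one_line n \<sigma>" by blast
    have ivl: "set [1..<Suc n] = {1..n}" by auto
    show "xs \<in> {xs. distinct xs \<and> set xs = {1..n}}"
      using \<sigma>(1) unfolding \<sigma>(2) one_line_def mem_Collect_eq distinct_map set_map ivl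
      by (simp add: permutes_image permutes_inj_on del: upt_Suc)
  next
    fix xs :: "nat list" assume "xs \<in> {xs. distinct xs \<and> set xs = {1..n}}"
    then have xs: "distinct xs" "set xs = {1..n}" by auto
    then have len: "length xs = n"
      using distinct_card[of xs] by simp
    \<comment> \<open>List positions count from 0, permutation arguments from 1; the identity
      outside \<open>{1..n}\<close> is demanded by \<open>permutes\<close>.\<close>
    define \<sigma> where "\<sigma> i = (if i \<in> {1..n} then xs ! (i - 1) else i)" for i
    have "bij_betw (\<lambda>i. xs ! (i - 1)) {1..n} {1..n}"
    proof -
      have "bij_betw (\<lambda>i. i - 1) {1..n} {..<n}"
        by (rule bij_betw_byWitness[where f' = Suc]) auto
      moreover have "bij_betw ((!) xs) {..<n} {1..n}"
        using bij_betw_nth[OF xs(1)] len xs(2) by simp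
      ultimately show ?thesis
        using bij_betw_trans[of "\<lambda>i. i - 1" _ _ "(!) xs"] by (simp only: o_def)
    qed
    then have "bij_betw \<sigma> {1..n} {1..n}"
      by (rule bij_betw_cong[THEN iffD1, rotated]) (simp add: \<sigma>_def)
    then have "\<sigma> permutes {1..n}"
      by (rule bij_imp_permutes) (auto simp: \<sigma>_def)
    moreover have "one_line n \<sigma> = xs"
      by (rule nth_equalityI) (auto simp: len \<sigma>_def)
    ultimately show "xs \<in> one_line n ` {\<sigma>. \<sigma> permutes {1..n}}" by blast
  qed
qed

lemma list_avoids_312_iff_nth:
  "list_avoids_312 xs \<longleftrightarrow>
    \<not> (\<exists>i j l. i < j \<and> j < l \<and> l < length xs \<and> xs ! j < xs ! l \<and> xs ! l < xs ! i)"
proof (induction xs)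
  case (Cons x xs)
  have "(\<exists>i j l. i < j \<and> j < l \<and> l < length (x # xs) \<and> (x # xs) ! j < (x # xs) ! l \<and>
          (x # xs) ! l < (x # xs) ! i) \<longleftrightarrow>
        (\<exists>j l. j < l \<and> l < length xs \<and> xs ! j < xs ! l \<and> xs ! l < x) \<or>
        (\<exists>i j l. i < j \<and> j < l \<and> l < length xs \<and> xs ! j < xs ! l \<and> xs ! l < xs ! i)"
    (is "?L \<longleftrightarrow> ?R1 \<or> ?R2")
  proof
    assume ?L
    then obtain i j l where *: "i < j" "j < l" "l < length (x # xs)"
      "(x # xs) ! j < (x # xs) ! l" "(x # xs) ! l < (x # xs) ! i" by blast
    \<comment> \<open>Only \<open>i\<close> can be 0, in which case \<open>x\<close> plays the 3;
      \<open>j\<close> and \<open>l\<close> always point into the tail.\<close>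
    then obtain j' l' where "j = Suc j'" "l = Suc l'"
      by (metis less_imp_Suc_add)
    with * show "?R1 \<or> ?R2"
      by (cases i) auto
  next
    assume "?R1 \<or> ?R2"
    then show ?L
    proof
      assume ?R1
      then obtain j l where "j < l" "l < length xs" "xs ! j < xs ! l" "xs ! l < x" by blast
      then show ?L by (intro exI[of _ 0] exI[of _ "Suc j"] exI[of _ "Suc l"]) auto
    next
      assume ?R2
      then obtain i j l where "i < j" "j < l" "l < length xs" "xs ! j < xs ! l" "xs ! l < xs ! i"
        by blast
      then show ?L by (intro exI[of _ "Suc i"] exI[of _ "Suc j"] exI[of _ "Suc l"]) auto
    qed
  qed
  then show ?case
    using Cons by (auto simp: sorted_wrt_iff_nth_less)
qed auto

lemma avoids_312_iff_one_line: "avoids_312 n \<sigma> \<longleftrightarrow> list_avoids_312 (one_line n \<sigma>)"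
proof -
  have "(\<exists>i j l. 1 \<le> i \<and> i < j \<and> j < l \<and> l \<le> n \<and> \<sigma> j < \<sigma> l \<and> \<sigma> l < \<sigma> i) \<longleftrightarrow>
    (\<exists>i j l. i < j \<and> j < l \<and> l < n \<and> \<sigma> (Suc j) < \<sigma> (Suc l) \<and> \<sigma> (Suc l) < \<sigma> (Suc i))"
    (is "?L \<longleftrightarrow> ?R")
  proof
    assume ?L
    then obtain i j l where *: "1 \<le> i" "i < j" "j < l" "l \<le> n" "\<sigma> j < \<sigma> l" "\<sigma> l < \<sigma> i" by blast
    then show ?R
      by (intro exI[of _ "i - 1"] exI[of _ "j - 1"] exI[of _ "l - 1"]) auto
  next
    assume ?R
    then obtain i j l where *: "i < j" "j < l" "l < n" "\<sigma> (Suc j) < \<sigma> (Suc l)"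
      "\<sigma> (Suc l) < \<sigma> (Suc i)" by blast
    then show ?L
      by (intro exI[of _ "Suc i"] exI[of _ "Suc j"] exI[of _ "Suc l"]) auto
  qed
  also have "\<dots> \<longleftrightarrow> (\<exists>i j l. i < j \<and> j < l \<and> l < length (one_line n \<sigma>) \<and>
      one_line n \<sigma> ! j < one_line n \<sigma> ! l \<and> one_line n \<sigma> ! l < one_line n \<sigma> ! i)"
    by (intro ex_cong1) auto
  finally show ?thesis
    unfolding avoids_312_def list_avoids_312_iff_nth by blast
qed

lemma runs3_one_line:
  "runs3 P (one_line n \<sigma>) =
    card {i. 1 \<le> i \<and> i + 2 \<le> n \<and> P (\<sigma> i) (\<sigma> (i + 1)) \<and> P (\<sigma> (i + 1)) (\<sigma> (i + 2))}"
    (is "_ = card ?B")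
proof -
  let ?A = "{i. i + 2 < length (one_line n \<sigma>) \<and>
    P (one_line n \<sigma> ! i) (one_line n \<sigma> ! (i + 1)) \<and>
    P (one_line n \<sigma> ! (i + 1)) (one_line n \<sigma> ! (i + 2))}"
  have "i \<in> ?B \<longleftrightarrow> i \<in> Suc ` ?A" for i
    by (cases i) (auto simp: image_iff)
  then have "?B = Suc ` ?A"
    by blast
  then show ?thesis
    by (simp only: runs3_conv_card card_image[OF inj_Suc])
qed

lemma card_occ_123: "card (occ_123 n \<sigma>) = runs3 (<) (one_line n \<sigma>)"
  by (simp add: occ_123_def runs3_one_line)

text \<open>Reversal expresses 321 through \<open><\<close> as well, so that the split at the
  minimum covers both patterns.\<close>

lemma card_occ_321: "card (occ_321 n \<sigma>) = runs3 (<) (rev (one_line n \<sigma>))"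
  by (simp add: occ_321_def runs3_one_line runs3_rev)

section \<open>Comparison of the counts\<close>

lemma bij_betw_restrict_preimage:
  assumes "bij_betw f A B"
  shows "bij_betw f {x \<in> A. Q (f x)} {y \<in> B. Q y}"
proof (rule bij_betw_subset[OF assms])
  show "f ` {x \<in> A. Q (f x)} = {y \<in> B. Q y}"
    unfolding bij_betw_imp_surj_on[OF assms, symmetric] by blast
qed blast

text \<open>Permutations and trees are both in bijection with the same set of words. Keeping
  \<open>stat\<close> general lets one argument serve both patterns.\<close>

lemma num_avoiders_conv_trees:
  assumes "\<And>\<sigma>. card (occ n \<sigma>) = stat (one_line n \<sigma>)"
  shows "num_avoiders occ n k = card {t. size t = n \<and> stat (tree_word 1 t) = k}"
proof -
  let ?X = "{xs. distinct xs \<and> set xs = {1..n} \<and> list_avoids_312 xs \<and> stat xs = k}"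
  have "bij_betw (one_line n)
      {\<sigma>. \<sigma> permutes {1..n} \<and> avoids_312 n \<sigma> \<and> card (occ n \<sigma>) = k} ?X"
    using bij_betw_restrict_preimage[OF bij_betw_one_line,
        of n "\<lambda>xs. list_avoids_312 xs \<and> stat xs = k"]
    unfolding mem_Collect_eq conj_assoc avoids_312_iff_one_line assms .
  moreover have "bij_betw (tree_word 1) {t. size t = n \<and> stat (tree_word 1 t) = k} ?X"
    using bij_betw_restrict_preimage[OF bij_betw_tree_word, of n "\<lambda>xs. stat xs = k"]
    unfolding mem_Collect_eq conj_assoc .
  ultimately show ?thesis
    unfolding num_avoiders_def by (simp only: bij_betw_same_card)
qed

lemma num_avoiders_123_eq_321: "num_avoiders occ_123 n k = num_avoiders occ_321 n k"
proof -
  have "num_avoiders occ_123 n k = card {t. size t = n \<and> runs3 (<) (tree_word 1 t) = k}"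
    by (rule num_avoiders_conv_trees) (rule card_occ_123)
  also have "\<dots> = card {t. size t = n \<and> runs3 (<) (rev (tree_word 1 t)) = k}"
    \<comment> \<open>\<open>mirror\<close> is a size-preserving involution that carries one
      statistic to the other.\<close>
    by (rule bij_betw_same_card[OF bij_betw_byWitness[where f = mirror and f' = mirror]])
      (auto simp: runs3_rev_tree_word[where b = 1])
  also have "\<dots> = num_avoiders occ_321 n k"
    by (rule num_avoiders_conv_trees[symmetric]) (rule card_occ_321)
  finally show ?thesis .
qed

theorem theorem8: "avoiders_gf occ_123 = avoiders_gf occ_321"
  by (simp add: avoiders_gf_def num_avoiders_123_eq_321)

end
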